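(* Let $A\in\mathbb{C}^{n\times n}$. If $\operatorname{rank} A=1$, then $A$ is $\mathcal U$-apportionable, i.e., there exists a unitary matrix $U\in\mathbb{C}^{n\times n}$ such that all entries of $UAU^*$ have the same absolute value.
   Context: A complex square matrix $B=[b_{kj}]$ is uniform if there is a real number $c\ge 0$ with $|b_{kj}|=c$ for all $k,j$. A matrix $A\in\mathbb{C}^{n\times n}$ is $\mathcal U$-apportionable (unitarily apportionable) if there is an $n\times n$ unitary matrix $U$ such that $UAU^*$ is uniform. *)

theory Defs
  imports "HOL-Analysis.Analysis"
begin

definition ctranspose :: "complex^'n^'m \<Rightarrow> complex^'m^'n" where
  "ctranspose A = (\<chi> i j. cnj (A $ j $ i))"

definition unitary_matrix :: "complex^'n^'n \<Rightarrow> bool" where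
  "unitary_matrix U \<longleftrightarrow> U ** ctranspose U = mat 1 \<and> ctranspose U ** U = mat 1"

definition uniform_matrix :: "complex^'n^'n \<Rightarrow> bool" where
  "uniform_matrix B \<longleftrightarrow> (\<exists>c::real. c \<ge> 0 \<and> (\<forall>k j. cmod (B $ k $ j) = c))"

definition unitarily_apportionable :: "complex^'n^'n \<Rightarrow> bool" where
  "unitarily_apportionable A \<longleftrightarrow>
     (\<exists>U::complex^'n^'n. unitary_matrix U \<and> uniform_matrix (U ** A ** ctranspose U))"

end

theory Submission
  imports Defs
begin

text \<open>
  A rank one matrix is \<open>x y\<^sup>*\<close>, so conjugating by \<open>U\<close> gives \<open>(U x) (U y)\<^sup>*\<close>, and it suffices
  that \<open>U x\<close> and \<open>U y\<close> each have entries of constant modulus. Since unitary matrices act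
  transitively on pairs of vectors with prescribed norms and inner product, this amounts to finding
  unimodular numbers with a prescribed mean \<open>c\<close>, where \<open>\<bar>c\<bar> \<le> 1\<close>. For \<open>n \<ge> 2\<close> the modulus of
  \<open>\<Sum>k<n. cis (k t)\<close> moves continuously from \<open>n\<close> at \<open>t = 0\<close> to \<open>0\<close> at \<open>t = 2 \<pi> / n\<close>, so it
  takes the value \<open>n \<bar>c\<bar>\<close>, and a rotation adjusts the argument.
\<close>

text \<open>The Hermitian product, complex-valued and linear in the first argument;
  \<open>inner\<close> on this type is only its real part.\<close>

definition hinner :: "complex^'n \<Rightarrow> complex^'n \<Rightarrow> complex" where
  "hinner x y = (\<Sum>k\<in>UNIV. x $ k * cnj (y $ k))"

lemma hinner_diff_left: "hinner (x - y) z = hinner x z - hinner y z"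
  by (simp add: hinner_def algebra_simps sum_subtractf)

lemma hinner_diff_right: "hinner x (y - z) = hinner x y - hinner x z"
  by (simp add: hinner_def algebra_simps sum_subtractf)

lemma cnj_hinner: "cnj (hinner x y) = hinner y x"
  by (simp add: hinner_def mult.commute)

lemma hinner_self: "hinner x x = of_real ((norm x)\<^sup>2)"
  by (simp add: hinner_def norm_vec_def L2_set_def sum_nonneg complex_norm_square flip: of_real_power)

lemma norm_hinner_le: "norm (hinner x y) \<le> norm x * norm y"
proof -
  have "norm (hinner x y) \<le> (\<Sum>k\<in>UNIV. norm (x $ k) * norm (y $ k))"
    unfolding hinner_def by (rule order_trans[OF norm_sum]) (simp add: norm_mult)
  also have "\<dots> \<le> norm x * norm y"
    using L2_set_mult_ineq[of "\<lambda>k. norm (x $ k)" "\<lambda>k. norm (y $ k)" UNIV]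
    by (simp add: norm_vec_def)
  finally show ?thesis .
qed

lemma hinner_unitary:
  assumes "unitary_matrix U"
  shows "hinner (U *v x) (U *v y) = hinner x y"
proof -
  have U: "(\<Sum>k\<in>UNIV. U $ k $ i * cnj (U $ k $ j)) = (if i = j then 1 else 0)" for i j
  proof -
    have "(ctranspose U ** U) $ j $ i = mat 1 $ j $ i"
      using assms by (simp add: unitary_matrix_def)
    then show ?thesis
      by (auto simp: matrix_matrix_mult_def ctranspose_def mat_def mult.commute)
  qed
  have "hinner (U *v x) (U *v y) =
      (\<Sum>k\<in>UNIV. \<Sum>i\<in>UNIV. \<Sum>j\<in>UNIV. U $ k $ i * x $ i * (cnj (U $ k $ j) * cnj (y $ j)))"
    by (simp add: hinner_def matrix_vector_mult_def sum_product)
  also have "\<dots> = (\<Sum>i\<in>UNIV. \<Sum>j\<in>UNIV. \<Sum>k\<in>UNIV. U $ k $ i * x $ i * (cnj (U $ k $ j) * cnj (y $ j)))"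
    by (subst sum.swap) (rule sum.cong[OF refl], rule sum.swap)
  also have "\<dots> = (\<Sum>i\<in>UNIV. \<Sum>j\<in>UNIV. (x $ i * cnj (y $ j)) * (\<Sum>k\<in>UNIV. U $ k $ i * cnj (U $ k $ j)))"
    by (simp add: sum_distrib_left mult_ac)
  also have "\<dots> = hinner x y"
    by (simp add: U hinner_def if_distrib cong: if_cong)
  finally show ?thesis .
qed

lemma unitary_mult:
  assumes "unitary_matrix U" "unitary_matrix V"
  shows "unitary_matrix (U ** V)"
proof -
  have "ctranspose (U ** V) = ctranspose V ** ctranspose U"
    by (simp add: ctranspose_def matrix_matrix_mult_def vec_eq_iff mult.commute)
  moreover have "U ** V ** (ctranspose V ** ctranspose U) = U ** (V ** ctranspose V) ** ctranspose U"
    "ctranspose V ** ctranspose U ** (U ** V) = ctranspose V ** (ctranspose U ** U) ** V"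
    by (simp_all add: matrix_mul_assoc)
  ultimately show ?thesis
    using assms by (simp add: unitary_matrix_def)
qed

lemma unitary_mat_1: "unitary_matrix (mat 1 :: complex^'n^'n)"
proof -
  have "ctranspose (mat 1) = (mat 1 :: complex^'n^'n)"
    by (auto simp: ctranspose_def mat_def vec_eq_iff)
  then show ?thesis by (simp add: unitary_matrix_def)
qed

text \<open>The clause on vectors orthogonal to \<open>x - u\<close> lets a second transport leave
  the image of the first one in place.\<close>

lemma exists_unitary_transport:
  fixes x u :: "complex^'n"
  assumes "norm x = norm u"
  shows "\<exists>U. unitary_matrix U \<and> U *v x = u \<and> (\<forall>z. hinner z (x - u) = 0 \<longrightarrow> U *v z = z)"
proof (cases "x = u")
  case True
  then show ?thesis using unitary_mat_1 by auto
next
  case False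
  define w where "w = x - u"
  define a where "a = hinner x w"
  \<comment> \<open>\<open>H = I - w w\<^sup>* / a\<close> is a complex reflection: \<open>\<parallel>w\<parallel>\<^sup>2 = 2 Re a\<close> makes its eigenvalue
    \<open>1 - \<parallel>w\<parallel>\<^sup>2 / a = - cnj a / a\<close> on \<open>w\<close> unimodular.\<close>
  define H :: "complex^'n^'n" where "H = (\<chi> i j. (if i = j then 1 else 0) - w $ i * cnj (w $ j) / a)"
  \<comment> \<open>Equal norms give \<open>a\<close> =
    \<open>(norm x)\<^sup>2 - hinner x u\<close>, and twice its real part is the squared norm of
    \<open>x - u\<close>.\<close>
  have ww: "hinner w w = a + cnj a"
    using assms hinner_self[of x] hinner_self[of u]
    by (simp add: a_def w_def hinner_diff_left hinner_diff_right cnj_hinner)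
  have "hinner w w \<noteq> 0"
    using False by (simp add: hinner_self w_def)
  then have a: "a \<noteq> 0" using ww by auto
  have Hv: "H *v z = z - (\<chi> i. w $ i * hinner z w / a)" for z
  proof -
    have "(H *v z) $ i = (\<Sum>j\<in>UNIV. (if i = j then z $ j else 0) - w $ i * (z $ j * cnj (w $ j)) / a)" for i
      unfolding H_def matrix_vector_mult_def by (simp, intro sum.cong refl) (simp add: algebra_simps)
    then show ?thesis
      by (simp add: vec_eq_iff hinner_def sum_subtractf sum_distrib_left sum_divide_distrib)
  qed
  have "H *v x = u"
    using a by (simp add: Hv flip: a_def) (simp add: w_def vec_eq_iff)
  moreover have "H *v z = z" if "hinner z w = 0" for z
    using that by (simp add: Hv vec_eq_iff)
  moreover have "H ** ctranspose H = mat 1"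
  proof -
    have "(H ** ctranspose H) $ i $ j = mat 1 $ i $ j" for i j
    proof -
      have "(H ** ctranspose H) $ i $ j = (\<Sum>k\<in>UNIV.
          (if i = k then if j = k then 1 else 0 else 0)
          - (if i = k then w $ k * cnj (w $ j) / cnj a else 0)
          - (if j = k then w $ i * cnj (w $ k) / a else 0)
          + w $ i * cnj (w $ j) / (a * cnj a) * (w $ k * cnj (w $ k)))"
        by (simp add: H_def ctranspose_def matrix_matrix_mult_def)
          (rule sum.cong[OF refl], auto simp: algebra_simps)
      \<comment> \<open>The three multiples of \<open>w w\<^sup>*\<close> cancel, since 1/a + 1/cnj
        a = (a + cnj a)/(a cnj a).\<close>
      also have "\<dots> = (if i = j then 1 else 0) - w $ i * cnj (w $ j) / cnj a
          - w $ i * cnj (w $ j) / a + w $ i * cnj (w $ j) / (a * cnj a) * (a + cnj a)"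
        unfolding ww[symmetric]
        by (simp add: sum.distrib sum_subtractf hinner_def sum_distrib_left sum_divide_distrib)
      also have "\<dots> = mat 1 $ i $ j"
        using a by (simp add: mat_def field_simps)
      finally show ?thesis .
    qed
    then show ?thesis by (simp add: vec_eq_iff)
  qed
  ultimately show ?thesis
    unfolding unitary_matrix_def w_def using matrix_left_right_inverse by blast
qed

lemma exists_unitary_transport_pair:
  fixes x y u v :: "complex^'n"
  assumes "norm x = norm u" "norm y = norm v" "hinner x y = hinner u v"
  shows "\<exists>U. unitary_matrix U \<and> U *v x = u \<and> U *v y = v"
proof -
  \<comment> \<open>The second reflection fixes \<open>u\<close>, as equal inner products make \<open>u\<close> orthogonal to \<open>V y - v\<close>.\<close>
  obtain V where V: "unitary_matrix V" "V *v x = u"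
    using exists_unitary_transport[OF assms(1)] by blast
  have xy: "hinner u (V *v y) = hinner u v"
    using hinner_unitary[OF V(1), of x y] V(2) assms(3) by simp
  have "complex_of_real ((norm (V *v y))\<^sup>2) = of_real ((norm v)\<^sup>2)"
    using hinner_unitary[OF V(1), of y y] assms(2) by (simp add: hinner_self del: of_real_power)
  then have "norm (V *v y) = norm v"
    by (simp del: of_real_power)
  then obtain W where W: "unitary_matrix W" "W *v (V *v y) = v"
      "\<And>z. hinner z (V *v y - v) = 0 \<Longrightarrow> W *v z = z"
    using exists_unitary_transport by blast
  have "W *v u = u"
    using W(3) xy by (simp add: hinner_diff_right)
  then show ?thesis
    using V W unitary_mult by (metis matrix_vector_mul_assoc)
qed

lemma exists_unimodular_sum:
  fixes c :: complex
  assumes "CARD('n::finite) \<ge> 2" "norm c \<le> 1"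
  shows "\<exists>f :: 'n \<Rightarrow> complex. (\<forall>k. norm (f k) = 1) \<and> (\<Sum>k\<in>UNIV. f k) = of_nat CARD('n) * c"
proof -
  define n where "n = CARD('n)"
  obtain h :: "'n \<Rightarrow> nat" where h: "bij_betw h UNIV {..<n}"
    using ex_bij_betw_finite_nat[of "UNIV :: 'n set"] by (auto simp: n_def lessThan_atLeast0)
  define S where "S t = (\<Sum>k\<in>UNIV. cis (t * real (h k)))" for t
  \<comment> \<open>At this angle the summands run through all \<open>n\<close>-th roots of unity,
    whose sum vanishes for n \<ge> 2.\<close>
  have "S (2 * pi / n) = (\<Sum>j<n. cis (2 * pi * real j / n))"
    unfolding S_def using sum.reindex_bij_betw[OF h, of "\<lambda>j. cis (2 * pi * real j / n)"] by simp
  also have "\<dots> = \<Sum>{z. z ^ n = 1}"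
    using assms(1) by (intro sum.reindex_bij_betw Complex.bij_betw_roots_unity) (simp add: n_def)
  also have "\<dots> = 0"
    using assms(1) by (intro sum_roots_unity) (simp add: n_def)
  finally have S1: "S (2 * pi / n) = 0" .
  have S0: "S 0 = of_nat n"
    by (simp add: S_def n_def)
  have "\<exists>t. 0 \<le> t \<and> t \<le> 2 * pi / n \<and> norm (S t) = n * norm c"
  proof (rule IVT2')
    show "continuous_on {0..2 * pi / n} (\<lambda>t. norm (S t))"
      unfolding S_def by (intro continuous_intros)
  qed (use assms(2) S0 S1 in \<open>auto simp: mult_left_le\<close>)
  then obtain t where t: "norm (S t) = n * norm c" by blast
  \<comment> \<open>The rotation is the quotient of two numbers of equal modulus; if
    \<open>S t = 0\<close>, then \<open>c = 0\<close> and any unimodular \<open>e\<close> will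
    do.\<close>
  obtain e where e: "norm e = 1" "e * S t = of_nat n * c"
  proof (cases "S t = 0")
    case True
    then show ?thesis using that[of 1] t by (auto simp: n_def)
  next
    case False
    then have "norm (of_nat n * c / S t) = 1"
      using t by (metis divide_self norm_divide norm_eq_zero norm_mult norm_of_nat)
    then show ?thesis using that[of "of_nat n * c / S t"] False by simp
  qed
  show ?thesis
    by (rule exI[of _ "\<lambda>k. e * cis (t * real (h k))"])
      (use e in \<open>simp add: norm_mult S_def n_def flip: sum_distrib_left\<close>)
qed

lemma exists_uniform_pair:
  fixes x y :: "complex^'n"
  assumes "CARD('n) \<ge> 2"
  shows "\<exists>U r s. unitary_matrix U \<and> (\<forall>k. norm ((U *v x) $ k) = r) \<and> (\<forall>k. norm ((U *v y) $ k) = s)"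
proof -
  \<comment> \<open>If \<open>x\<close> or \<open>y\<close> is zero, division by zero makes
    \<open>c = 0\<close>, and the product formula for \<open>hinner x y\<close> still holds.\<close>
  define c where "c = hinner x y / of_real (norm x * norm y)"
  have xy: "hinner x y = of_real (norm x * norm y) * c"
    using norm_hinner_le[of x y] by (auto simp: c_def)
  have "norm c \<le> 1"
    using norm_hinner_le[of x y] by (simp add: c_def norm_divide norm_mult divide_le_eq_1 zero_less_mult_iff)
      (auto)
  with assms obtain f :: "'n \<Rightarrow> complex" where
    f: "\<And>k. norm (f k) = 1" "(\<Sum>k\<in>UNIV. f k) = of_nat CARD('n) * c"
    using exists_unimodular_sum by blast
  define q where "q = sqrt (real CARD('n))"
  have q: "q > 0" "q * q = real CARD('n)" "complex_of_real q * of_real q = of_nat CARD('n)"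
    by (simp_all add: q_def flip: of_real_mult)
  \<comment> \<open>Dividing by \<open>q\<close> matches the norms. With \<open>v\<close> constant,
    all phases sit in \<open>u\<close>, so \<open>hinner u v\<close> is
    \<open>norm x * norm y\<close> times the mean of \<open>f\<close>.\<close>
  define u :: "complex^'n" where "u = (\<chi> k. of_real (norm x / q) * f k)"
  define v :: "complex^'n" where "v = (\<chi> k. of_real (norm y / q))"
  have "norm x = norm u" "norm y = norm v"
    using q(1) f(1) by (simp_all add: u_def v_def norm_vec_def norm_mult norm_divide L2_set_constant
        L2_set_nonneg flip: q_def)
  moreover have "hinner u v = of_real (norm x / q) * of_real (norm y / q) * (\<Sum>k\<in>UNIV. f k)"
    unfolding hinner_def sum_distrib_left by (simp add: u_def v_def mult_ac)
  then have "hinner x y = hinner u v"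
    using q(1) by (simp add: xy f(2) flip: q(3))
  ultimately obtain U where U: "unitary_matrix U" "U *v x = u" "U *v y = v"
    using exists_unitary_transport_pair by blast
  then have "\<forall>k. norm ((U *v x) $ k) = norm x / q" "\<forall>k. norm ((U *v y) $ k) = norm y / q"
    using q(1) f(1) by (simp_all add: u_def v_def norm_mult norm_divide)
  with U(1) show ?thesis by blast
qed

text \<open>The row space is a line, so every row is a multiple of one vector \<open>r\<close>;
  \<open>y\<close> is the entrywise conjugate of \<open>r\<close>.\<close>

lemma rank_1_outer_product:
  fixes A :: "complex^'n^'m"
  assumes "rank A = 1"
  shows "\<exists>x y. A = (\<chi> i j. x $ i * cnj (y $ j))"
proof -
  have "vec.dim (rows A) = 1"
    using assms by (simp add: row_rank_def_gen)
  then obtain B where B: "rows A \<subseteq> vec.span B" "card B = 1"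
    using vec.basis_exists[of "rows A"] by metis
  then obtain r where "B = {r}" by (metis card_1_singletonE)
  then have "\<exists>c. A $ i = c *s r" for i
    using B(1) by (force simp: rows_def row_def vec.span_singleton)
  then obtain c where "\<And>i. A $ i = c i *s r" by metis
  then have "A = (\<chi> i j. (\<chi> i. c i) $ i * cnj ((\<chi> j. cnj (r $ j)) $ j))"
    by (simp add: vec_eq_iff)
  then show ?thesis by blast
qed

theorem theorem2p2:
  fixes A :: "complex^'n^'n"
  assumes "rank A = 1"
  shows "unitarily_apportionable A"
proof (cases "CARD('n) \<ge> 2")
  case True
  obtain x y where A: "A = (\<chi> i j. x $ i * cnj (y $ j))"
    using rank_1_outer_product[OF assms] by blast
  obtain U r s where U: "unitary_matrix U" and
    rs: "\<And>k. norm ((U *v x) $ k) = r" "\<And>k. norm ((U *v y) $ k) = s"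
    using exists_uniform_pair[OF True] by blast
  have "(U ** A ** ctranspose U) $ k $ j = (U *v x) $ k * cnj ((U *v y) $ j)" for k j
    by (simp add: A ctranspose_def matrix_matrix_mult_def matrix_vector_mult_def
        sum_distrib_left sum_distrib_right mult_ac)
  then have "norm ((U ** A ** ctranspose U) $ k $ j) = r * s" for k j
    using rs by (simp add: norm_mult)
  moreover have "r * s \<ge> 0"
    using rs by (metis mult_nonneg_nonneg norm_ge_zero)
  ultimately show ?thesis
    using U unfolding unitarily_apportionable_def uniform_matrix_def by blast
next
  \<comment> \<open>A single unimodular number cannot have a mean of modulus below 1, so this size
    is treated apart: all 1 by 1 matrices are uniform.\<close>
  case False
  then have "CARD('n) = 1"
    using zero_less_card_finite[where 'a='n] by linarith
  then have "k = i" for k i :: 'n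
    by (metis UNIV_I card_1_singletonE singletonD)
  then have "uniform_matrix (B :: complex^'n^'n)" for B
    unfolding uniform_matrix_def by (metis norm_ge_zero)
  then show ?thesis
    unfolding unitarily_apportionable_def using unitary_mat_1 by blast
qed

end
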